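(* Let $\mathcal H:\mathbb R_+^\star\times\mathbb R_+^\star\times\mathbb R\times\mathbb R\to\mathbb R$ satisfy properties ($\mathcal H$-1), ($\mathcal H$-2) and ($\mathcal H$-3) listed in the context. Then the hydrodynamic reconstruction and the source term $\mathcal S_i^n$ defined in the context verify: (a) if $h_i^n=0$, then $h^n_{i-\frac12,+}=h^n_{i+\frac12,-}=0$; (b) if $h_i^n=0$, then $\mathcal S_i^n=0$.
   Context: $g>0$ is the gravity constant. For each $i\in\mathbb Z$, $W_i^n=(h_i^n,q_i^n)^\intercal$ is the state (water height $h_i^n\ge0$, discharge) in cell $i$ at time $t^n$, $Z_i\in\mathbb R$ is the discrete topography in cell $i$, and $\Delta x>0$ is the cell size. Convention in dry areas: $q/h\to0$ and $q^2/h^3$ stays bounded as $h\to0$. Intermediate states: $(W^n_{i+\frac12},Z_{i+\frac12})=(W_i^n,Z_i)$ if $Z_i>Z_{i+1}$, and $(W^n_{i+1},Z_{i+1})$ otherwise (so $Z_{i+\frac12}=\max(Z_i,Z_{i+1})$); $W^n_{i+\frac12}=(h^n_{i+\frac12},q^n_{i+\frac12})^\intercal$. Approximate squared Froude number: $\mathrm{Fr}^2(h_L,h_R,\bar q)=\dfrac{\bar q^2(h_L+h_R)}{2g\,h_L^2h_R^2}$. Hydrodynamic reconstruction of the water heights: $$h^n_{i+\frac12,-}=\max\Big(0,\,h_i^n+(Z_i-Z_{i+\frac12})+2\,\mathrm{Fr}^2(h_i^n,h^n_{i+\frac12},q_i^n)\,\mathcal H(h_i^n,h^n_{i+\frac12},q_i^n,Z_{i+\frac12}-Z_i)\Big),$$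 $$h^n_{i-\frac12,+}=\max\Big(0,\,h_i^n+(Z_i-Z_{i-\frac12})+2\,\mathrm{Fr}^2(h_i^n,h^n_{i-\frac12},q_i^n)\,\mathcal H(h_i^n,h^n_{i-\frac12},q_i^n,Z_{i-\frac12}-Z_i)\Big).$$ Source term: $\mathcal S_i^n=(0,(\mathcal S_q)_i^n)^\intercal$ with $$\Delta x(\mathcal S_q)_i^n=-g\frac{2h^n_{i-\frac12,+}h^n_{i+\frac12,-}}{h^n_{i-\frac12,+}+h^n_{i+\frac12,-}}(Z_{i+\frac12}-Z_{i-\frac12})+\frac{4g}{h^n_{i-\frac12,+}+h^n_{i+\frac12,-}}\,\mathcal H\big(h^n_{i-\frac12,+},h^n_{i+\frac12,-},q_i^n,Z_{i+\frac12}-Z_{i-\frac12}\big)^3.$$ When $h_i^n=0$, these expressions are understood as their limits as $h_i^n\to0$. Properties of $\mathcal H$: ($\mathcal H$-1) $\mathcal H$ is continuous, and $\lim_{\Delta Z\to0}\mathcal H(h_L,h_R,\bar q,\Delta Z)=0$ for all $h_L>0$, $h_R>0$, $\bar q\in\mathbb R$. ($\mathcal H$-2) $\mathcal H(h_L,h_R,\bar q,\Delta Z)=\frac12(h_R-h_L)$ for all $(h_L,h_R,\bar q,\Delta Z)\in\mathbb R_+^\star\times\mathbb R_+^\star\times\mathbb R\times\mathbb R$ such that $\Delta Z=-(h_R-h_L)\big(1-\mathrm{Fr}^2(h_L,h_R,\bar q)\big)$ and $\mathrm{Fr}^2(h_L,h_R,\bar q)\ne1$. ($\mathcal H$-3)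 As $h_i^n\to0$ (with $q_i^n$ following the dry-area convention, and $h^n_{i\pm\frac12}$ being, by definition, either equal to $h_i^n$ or to the height of the neighbouring cell, held fixed): $\mathrm{Fr}^2(h_i^n,h^n_{i\pm\frac12},q_i^n)\,\mathcal H(h_i^n,h^n_{i\pm\frac12},q_i^n,Z_{i\pm\frac12}-Z_i)\to0$; $\ \frac{1}{h^n_{i-\frac12,+}+h^n_{i+\frac12,-}}\mathcal H(h^n_{i-\frac12,+},h^n_{i+\frac12,-},q_i^n,Z_{i+\frac12}-Z_{i-\frac12})^3\to0$; and $\ \frac{h^n_{i-\frac12,+}h^n_{i+\frac12,-}}{h^n_{i-\frac12,+}+h^n_{i+\frac12,-}}\to0$. *)

theory Defs
  imports Complex_Main
begin

type_synonym state = "real \<times> real"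

abbreviation height :: "state \<Rightarrow> real" where "height \<equiv> fst"
abbreviation discharge :: "state \<Rightarrow> real" where "discharge \<equiv> snd"

definition froude_sq :: "real \<Rightarrow> real \<Rightarrow> real \<Rightarrow> real \<Rightarrow> real" where
  "froude_sq g hL hR q = q\<^sup>2 * (hL + hR) / (2 * g * hL\<^sup>2 * hR\<^sup>2)"

(* The index i stands for the interface i + 1/2; the interface i - 1/2 has index i - 1. *)
definition interface :: "(int \<Rightarrow> real) \<Rightarrow> (int \<Rightarrow> state) \<Rightarrow> int \<Rightarrow> state \<times> real" where
  "interface Z W i = (if Z i > Z (i + 1) then (W i, Z i) else (W (i + 1), Z (i + 1)))"

definition h_interface :: "(int \<Rightarrow> real) \<Rightarrow> (int \<Rightarrow> state) \<Rightarrow> int \<Rightarrow> real" where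
  "h_interface Z W i = height (fst (interface Z W i))"

definition Z_interface :: "(int \<Rightarrow> real) \<Rightarrow> (int \<Rightarrow> state) \<Rightarrow> int \<Rightarrow> real" where
  "Z_interface Z W i = snd (interface Z W i)"

(* The function H is only meaningful for positive heights, but the formulas below also
   evaluate it at zero heights: a reconstructed height is often exactly 0 near a dry area,
   and a neighbouring cell can be dry. So H is total, with arbitrary values at nonpositive
   heights, where only property_H3 constrains it. Where a denominator vanishes because of
   a dry neighbour, or of two zero reconstructed heights, x / 0 = 0 applies. *)
type_synonym correction = "real \<Rightarrow> real \<Rightarrow> real \<Rightarrow> real \<Rightarrow> real"

definition froude_corr_minus ::
  "real \<Rightarrow> correction \<Rightarrow> (int \<Rightarrow> real) \<Rightarrow> (int \<Rightarrow> state) \<Rightarrow> int \<Rightarrow> real" where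
  "froude_corr_minus g H Z W i =
     froude_sq g (height (W i)) (h_interface Z W i) (discharge (W i))
     * H (height (W i)) (h_interface Z W i) (discharge (W i)) (Z_interface Z W i - Z i)"

definition froude_corr_plus ::
  "real \<Rightarrow> correction \<Rightarrow> (int \<Rightarrow> real) \<Rightarrow> (int \<Rightarrow> state) \<Rightarrow> int \<Rightarrow> real" where
  "froude_corr_plus g H Z W i =
     froude_sq g (height (W i)) (h_interface Z W (i - 1)) (discharge (W i))
     * H (height (W i)) (h_interface Z W (i - 1)) (discharge (W i)) (Z_interface Z W (i - 1) - Z i)"

(* The names ending in _wet are the formulas for a cell i with positive height. *)
definition h_minus_wet ::
  "real \<Rightarrow> correction \<Rightarrow> (int \<Rightarrow> real) \<Rightarrow> (int \<Rightarrow> state) \<Rightarrow> int \<Rightarrow> real" where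
  "h_minus_wet g H Z W i =
     max 0 (height (W i) + (Z i - Z_interface Z W i) + 2 * froude_corr_minus g H Z W i)"

definition h_plus_wet ::
  "real \<Rightarrow> correction \<Rightarrow> (int \<Rightarrow> real) \<Rightarrow> (int \<Rightarrow> state) \<Rightarrow> int \<Rightarrow> real" where
  "h_plus_wet g H Z W i =
     max 0 (height (W i) + (Z i - Z_interface Z W (i - 1)) + 2 * froude_corr_plus g H Z W i)"

definition source_q_wet ::
  "real \<Rightarrow> real \<Rightarrow> correction \<Rightarrow> (int \<Rightarrow> real) \<Rightarrow> (int \<Rightarrow> state) \<Rightarrow> int \<Rightarrow> real" where
  "source_q_wet g \<Delta>x H Z W i =
     (let hp = h_plus_wet g H Z W i;
          hm = h_minus_wet g H Z W i;
          \<Delta>Z = Z_interface Z W i - Z_interface Z W (i - 1)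
      in (- g * (2 * hp * hm / (hp + hm)) * \<Delta>Z
          + 4 * g / (hp + hm) * (H hp hm (discharge (W i)) \<Delta>Z) ^ 3) / \<Delta>x)"

definition dry_path :: "(nat \<Rightarrow> state) \<Rightarrow> bool" where
  "dry_path w \<longleftrightarrow>
     (\<forall>n. height (w n) > 0) \<and>
     (\<lambda>n. height (w n)) \<longlonglongrightarrow> 0 \<and>
     (\<lambda>n. discharge (w n) / height (w n)) \<longlonglongrightarrow> 0 \<and>
     Bseq (\<lambda>n. (discharge (w n))\<^sup>2 / height (w n) ^ 3)"

(* Limit of f W as the height in cell i tends to 0 within the dry-area convention. All
   other cells are held fixed; an interface state taken from cell i varies with it. *)
definition has_dry_limit :: "((int \<Rightarrow> state) \<Rightarrow> real) \<Rightarrow> (int \<Rightarrow> state) \<Rightarrow> int \<Rightarrow> real \<Rightarrow> bool" where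
  "has_dry_limit f W i L \<longleftrightarrow> (\<forall>w. dry_path w \<longrightarrow> (\<lambda>n. f (W(i := w n))) \<longlonglongrightarrow> L)"

definition dry_extension :: "((int \<Rightarrow> state) \<Rightarrow> real) \<Rightarrow> (int \<Rightarrow> state) \<Rightarrow> int \<Rightarrow> real" where
  "dry_extension f W i = (if height (W i) = 0 then THE L. has_dry_limit f W i L else f W)"

definition h_minus ::
  "real \<Rightarrow> correction \<Rightarrow> (int \<Rightarrow> real) \<Rightarrow> (int \<Rightarrow> state) \<Rightarrow> int \<Rightarrow> real" where
  "h_minus g H Z W i = dry_extension (\<lambda>V. h_minus_wet g H Z V i) W i"

definition h_plus ::
  "real \<Rightarrow> correction \<Rightarrow> (int \<Rightarrow> real) \<Rightarrow> (int \<Rightarrow> state) \<Rightarrow> int \<Rightarrow> real" where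
  "h_plus g H Z W i = dry_extension (\<lambda>V. h_plus_wet g H Z V i) W i"

definition source ::
  "real \<Rightarrow> real \<Rightarrow> correction \<Rightarrow> (int \<Rightarrow> real) \<Rightarrow> (int \<Rightarrow> state) \<Rightarrow> int \<Rightarrow> state" where
  "source g \<Delta>x H Z W i = (0, dry_extension (\<lambda>V. source_q_wet g \<Delta>x H Z V i) W i)"

(* Continuity is not required at the points with hL \<noteq> hR, Fr^2 = 1 and \<Delta>Z = 0. There it would
   contradict the rest of the hypotheses: letting q vary so that Fr^2 tends to 1, property_H2
   gives the value (hR - hL) / 2 along \<Delta>Z = - (hR - hL) * (1 - Fr^2), which tends to 0, whereas
   the limit in \<Delta>Z at the critical q must be 0. Omitting these points only weakens the
   hypothesis. *)
definition property_H1 :: "real \<Rightarrow> correction \<Rightarrow> bool" where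
  "property_H1 g H \<longleftrightarrow>
     continuous_on
       {(hL, hR, q, \<Delta>Z). hL > 0 \<and> hR > 0 \<and> \<not> (hL \<noteq> hR \<and> froude_sq g hL hR q = 1 \<and> \<Delta>Z = 0)}
       (\<lambda>(hL, hR, q, \<Delta>Z). H hL hR q \<Delta>Z) \<and>
     (\<forall>hL hR q. hL > 0 \<longrightarrow> hR > 0 \<longrightarrow> ((\<lambda>\<Delta>Z. H hL hR q \<Delta>Z) \<longlongrightarrow> 0) (at 0))"

definition property_H2 :: "real \<Rightarrow> correction \<Rightarrow> bool" where
  "property_H2 g H \<longleftrightarrow>
     (\<forall>hL hR q \<Delta>Z. hL > 0 \<longrightarrow> hR > 0 \<longrightarrow>
        \<Delta>Z = - (hR - hL) * (1 - froude_sq g hL hR q) \<longrightarrow> froude_sq g hL hR q \<noteq> 1 \<longrightarrow>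
        H hL hR q \<Delta>Z = 1 / 2 * (hR - hL))"

definition property_H3 :: "real \<Rightarrow> correction \<Rightarrow> bool" where
  "property_H3 g H \<longleftrightarrow>
     (\<forall>(Z :: int \<Rightarrow> real) (W :: int \<Rightarrow> state) i. (\<forall>j. height (W j) \<ge> 0) \<longrightarrow>
        has_dry_limit (\<lambda>V. froude_corr_minus g H Z V i) W i 0 \<and>
        has_dry_limit (\<lambda>V. froude_corr_plus g H Z V i) W i 0 \<and>
        has_dry_limit (\<lambda>V. 1 / (h_plus_wet g H Z V i + h_minus_wet g H Z V i)
          * (H (h_plus_wet g H Z V i) (h_minus_wet g H Z V i) (discharge (V i))
               (Z_interface Z V i - Z_interface Z V (i - 1))) ^ 3) W i 0 \<and>
        has_dry_limit (\<lambda>V. h_plus_wet g H Z V i * h_minus_wet g H Z V i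
          / (h_plus_wet g H Z V i + h_minus_wet g H Z V i)) W i 0)"

end

theory Submission
  imports Defs
begin

text \<open>
  All quantities in a dry cell are limits along dry paths, so the theorem amounts to computing
  these limits. The decisive sign is that of the topography step: the interface
  topography is the maximum of the two adjacent values, so \<^term>\<open>Z i - Z_interface Z W i\<close> is
  nonpositive. When the height tends to \<open>0\<close> and, by \<^const>\<open>property_H3\<close>, the Froude correction
  vanishes, the quantity inside the \<open>max\<close> of the reconstruction tends to this nonpositive
  step, and the cut-off at \<open>0\<close> sends the reconstructed height to \<open>0\<close>. The source term is a linear
  combination of the two remaining expressions of \<^const>\<open>property_H3\<close>, whose coefficients depend
  only on \<open>g\<close>, \<open>\<Delta>x\<close> and the topography and hence stay constant along a dry path.
\<close>

text \<open>
  The topography at an interface is independent of the states, although it is selected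
  together with one; this is what makes it constant along a dry path.
\<close>
lemma Z_interface_eq_max: "Z_interface Z W i = max (Z i) (Z (i + 1))"
  by (simp add: Z_interface_def interface_def)

text \<open>
  Without a dry path every number would be a dry limit. Water at rest with vanishing height
  provides one.
\<close>
lemma dry_path_exists: "\<exists>w. dry_path w"
proof
  show "dry_path (\<lambda>n. (inverse (real (Suc n)), 0))"
    unfolding dry_path_def using LIMSEQ_inverse_real_of_nat by simp
qed

lemma has_dry_limit_unique:
  assumes "has_dry_limit f W i L" and "has_dry_limit f W i L'"
  shows "L = L'"
proof -
  obtain w where "dry_path w"
    using dry_path_exists ..
  then have "(\<lambda>n. f (W(i := w n))) \<longlonglongrightarrow> L" and "(\<lambda>n. f (W(i := w n))) \<longlonglongrightarrow> L'"
    using assms by (simp_all add: has_dry_limit_def)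
  then show ?thesis
    by (rule LIMSEQ_unique)
qed

lemma dry_extension_eq_limit:
  assumes "height (W i) = 0" and "has_dry_limit f W i L"
  shows "dry_extension f W i = L"
proof -
  have "(THE L. has_dry_limit f W i L) = L"
    using assms(2) by (rule the_equality) (rule has_dry_limit_unique[OF _ assms(2)])
  then show ?thesis
    by (simp add: dry_extension_def assms(1))
qed

lemma has_dry_limit_add:
  assumes "has_dry_limit f W i L" and "has_dry_limit f' W i L'"
  shows "has_dry_limit (\<lambda>V. f V + f' V) W i (L + L')"
  using assms by (simp add: has_dry_limit_def tendsto_add)

lemma has_dry_limit_cmult:
  assumes "has_dry_limit f W i L"
  shows "has_dry_limit (\<lambda>V. c * f V) W i (c * L)"
  using assms by (simp add: has_dry_limit_def tendsto_mult_left)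

text \<open>
  Both reconstructions have this form. The quantity inside the maximum tends to \<open>s\<close>, and the
  sign of \<open>s\<close> lets the cut-off absorb it.
\<close>
lemma has_dry_limit_reconstruction:
  assumes "s \<le> 0" and "has_dry_limit c W i 0"
  shows "has_dry_limit (\<lambda>V. max 0 (height (V i) + s + 2 * c V)) W i 0"
  unfolding has_dry_limit_def
proof (intro allI impI)
  fix w assume w: "dry_path w"
  have "(\<lambda>n. height ((W(i := w n)) i)) \<longlonglongrightarrow> 0"
    using w by (simp add: dry_path_def)
  moreover have "(\<lambda>n. c (W(i := w n))) \<longlonglongrightarrow> 0"
    using assms(2) w by (simp add: has_dry_limit_def)
  ultimately have "(\<lambda>n. max 0 (height ((W(i := w n)) i) + s + 2 * c (W(i := w n))))
      \<longlonglongrightarrow> max 0 (0 + s + 2 * 0)"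
    by (intro tendsto_intros)
  then show "(\<lambda>n. max 0 (height ((W(i := w n)) i) + s + 2 * c (W(i := w n)))) \<longlonglongrightarrow> 0"
    using assms(1) by simp
qed

lemma h_minus_wet_dry_limit:
  assumes "property_H3 g H" and "\<forall>j. height (W j) \<ge> 0"
  shows "has_dry_limit (\<lambda>V. h_minus_wet g H Z V i) W i 0"
  unfolding h_minus_wet_def Z_interface_eq_max
proof (rule has_dry_limit_reconstruction)
  show "has_dry_limit (\<lambda>V. froude_corr_minus g H Z V i) W i 0"
    using assms by (simp add: property_H3_def)
qed simp

lemma h_plus_wet_dry_limit:
  assumes "property_H3 g H" and "\<forall>j. height (W j) \<ge> 0"
  shows "has_dry_limit (\<lambda>V. h_plus_wet g H Z V i) W i 0"
  unfolding h_plus_wet_def Z_interface_eq_max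
proof (rule has_dry_limit_reconstruction)
  show "has_dry_limit (\<lambda>V. froude_corr_plus g H Z V i) W i 0"
    using assms by (simp add: property_H3_def)
qed simp

text \<open>
  Both reconstructed heights tend to \<open>0\<close>, so the quotients in the source term are of the form
  \<open>0 / 0\<close>. Their limits are those given by \<^const>\<open>property_H3\<close>, up to factors that are constant
  because the topography jump across the cell is independent of the states.
\<close>
lemma source_q_wet_dry_limit:
  assumes "property_H3 g H" and "\<forall>j. height (W j) \<ge> 0"
  shows "has_dry_limit (\<lambda>V. source_q_wet g \<Delta>x H Z V i) W i 0"
proof -
  define \<Delta>Z where "\<Delta>Z = max (Z i) (Z (i + 1)) - max (Z (i - 1)) (Z i)"
  define mean where "mean = (\<lambda>V. h_plus_wet g H Z V i * h_minus_wet g H Z V i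
      / (h_plus_wet g H Z V i + h_minus_wet g H Z V i))"
  define cubic where "cubic = (\<lambda>V. 1 / (h_plus_wet g H Z V i + h_minus_wet g H Z V i)
      * (H (h_plus_wet g H Z V i) (h_minus_wet g H Z V i) (discharge (V i))
          (Z_interface Z V i - Z_interface Z V (i - 1))) ^ 3)"
  have step: "Z_interface Z V i - Z_interface Z V (i - 1) = \<Delta>Z" for V
    by (simp add: Z_interface_eq_max \<Delta>Z_def)
  have "has_dry_limit mean W i 0"
    using assms by (simp add: property_H3_def mean_def)
  moreover have "has_dry_limit cubic W i 0"
    using assms by (simp add: property_H3_def cubic_def)
  ultimately have "has_dry_limit
      (\<lambda>V. (- 2 * g * \<Delta>Z / \<Delta>x) * mean V + (4 * g / \<Delta>x) * cubic V) W i
      ((- 2 * g * \<Delta>Z / \<Delta>x) * 0 + (4 * g / \<Delta>x) * 0)"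
    by (intro has_dry_limit_add has_dry_limit_cmult)
  moreover have "source_q_wet g \<Delta>x H Z V i
      = (- 2 * g * \<Delta>Z / \<Delta>x) * mean V + (4 * g / \<Delta>x) * cubic V" for V
    by (simp add: source_q_wet_def Let_def step mean_def cubic_def add_divide_distrib
        diff_divide_distrib mult_ac)
  ultimately show ?thesis by simp
qed

theorem lemma3:
  fixes g \<Delta>x :: real and H :: "real \<Rightarrow> real \<Rightarrow> real \<Rightarrow> real \<Rightarrow> real"
    and Z :: "int \<Rightarrow> real" and W :: "int \<Rightarrow> real \<times> real" and i :: int
  assumes "g > 0" and "\<Delta>x > 0" and "\<forall>j. height (W j) \<ge> 0"
    and "property_H1 g H" and "property_H2 g H" and "property_H3 g H"
  shows "(height (W i) = 0 \<longrightarrow> h_plus g H Z W i = 0 \<and> h_minus g H Z W i = 0) \<and>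
         (height (W i) = 0 \<longrightarrow> source g \<Delta>x H Z W i = (0, 0))"
  unfolding h_plus_def h_minus_def source_def
  using dry_extension_eq_limit[OF _ h_plus_wet_dry_limit[OF assms(6,3)]]
    dry_extension_eq_limit[OF _ h_minus_wet_dry_limit[OF assms(6,3)]]
    dry_extension_eq_limit[OF _ source_q_wet_dry_limit[OF assms(6,3)]]
  by simp

end
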